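(* Let $K\ge 1$, $\mathcal K=\{1,\dots,K\}$, let $\mathcal N\subseteq\mathcal K$ be the set of indices of true null hypotheses, $K_0=|\mathcal N|$, and let $\mathbf P=(P_1,\dots,P_K)$ be a random vector of p-values on a probability space with probability measure $\mathbb P$. Suppose that the null p-values $(P_k)_{k\in\mathcal N}$ are iid uniform on $[0,1]$ and that the vector $(P_k)_{k\in\mathcal N}$ is independent of the vector of non-null p-values $(P_k)_{k\in\mathcal K\setminus\mathcal N}$. Let $\alpha\in(0,1)$ and let $\mathcal D$ be the Benjamini-Hochberg (BH) procedure at level $\alpha$ applied to $\mathbf P$. Then its false discovery rate satisfies $$\mathrm{FDR}_{\mathcal D}=\mathbb E\left[\frac{F_{\mathcal D}}{R_{\mathcal D}\vee 1}\right]=\frac{\alpha K_0}{K}.$$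
   Context: Hypotheses $H_1,\dots,H_K$ are tested; $\mathcal N\subseteq\mathcal K$ is the (deterministic) set of indices of the true null hypotheses. For each $k\in\mathcal K$, $P_k$ is a $[0,\infty)$-valued random variable (the p-value of $H_k$). The non-null p-values ($k\notin\mathcal N$) are arbitrary random variables with arbitrary joint distribution. A testing procedure is a map $\mathcal D:[0,\infty)^K\to 2^{\mathcal K}$ that takes the p-values as input and returns the set of indices of rejected hypotheses. $\mathcal D$ is identified with its random output $\mathcal D(\mathbf P)$. $R_{\mathcal D}=|\mathcal D|$ is the number of discoveries and $F_{\mathcal D}=|\mathcal D\cap\mathcal N|$ is the number of false discoveries. The false discovery rate is $\mathrm{FDR}_{\mathcal D}=\mathbb E[F_{\mathcal D}/(R_{\mathcal D}\vee 1)]$, with expectation under $\mathbb P$; here $x\vee y=\max(x,y)$. BH procedure at level $\alpha$: for input $(p_1,\dots,p_K)$ let $p_{(1)}\le\dots\le p_{(K)}$ be the order statistics from smallest to largest and let $$k^*=\max\left\{k\in\mathcal K:\frac{K p_{(k)}}{k}\le\alpha\right\},\qquad \max(\varnothing)=0.$$ The procedure rejects the hypotheses with the $k^*$ smallest p-values and accepts the rest, i.e. the output is $\{k\in\mathcal K: p_k\le p_{(k^* )}\}$ if $k^*\ge 1$ and $\varnothing$ if $k^*=0$ (by maximality of $k^*$ there is no tie between $p_{(k^* )}$ and $p_{(k^*+1)}$). *)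

theory Defs
  imports "HOL-Probability.Probability"
begin

(* A vector of K p-values is a function nat => real of which only the values at
   the indices 1, ..., K are relevant. *)

type_synonym testing_procedure = "(nat \<Rightarrow> real) \<Rightarrow> nat set"

(* The k-th smallest of p 1, ..., p K, counted with multiplicity; meaningful for 1 <= k <= K. *)
definition order_stat :: "nat \<Rightarrow> (nat \<Rightarrow> real) \<Rightarrow> nat \<Rightarrow> real" where
  "order_stat K p k = sort (map p [1..<Suc K]) ! (k - 1)"

(* Inserting 0 realises the convention max {} = 0, as all other elements are positive. *)
definition bh_count :: "nat \<Rightarrow> real \<Rightarrow> (nat \<Rightarrow> real) \<Rightarrow> nat" where
  "bh_count K \<alpha> p =
     Max (insert 0 {k \<in> {1..K}. real K * order_stat K p k / real k \<le> \<alpha>})"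

definition bh :: "nat \<Rightarrow> real \<Rightarrow> testing_procedure" where
  "bh K \<alpha> p =
     (if bh_count K \<alpha> p = 0 then {}
      else {k \<in> {1..K}. p k \<le> order_stat K p (bh_count K \<alpha> p)})"

definition num_discoveries :: "nat set \<Rightarrow> nat" where
  "num_discoveries D = card D"

definition num_false_discoveries :: "nat set \<Rightarrow> nat set \<Rightarrow> nat" where
  "num_false_discoveries N D = card (D \<inter> N)"

definition fdr ::
  "'a measure \<Rightarrow> nat set \<Rightarrow> testing_procedure \<Rightarrow> (nat \<Rightarrow> 'a \<Rightarrow> real) \<Rightarrow> real" where
  "fdr M N \<D> P =
     prob_space.expectation M
       (\<lambda>\<omega>. real (num_false_discoveries N (\<D> (\<lambda>k. P k \<omega>))) /
             real (max (num_discoveries (\<D> (\<lambda>k. P k \<omega>))) 1))"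

end

theory Submission
  imports Defs
begin

text \<open>
  The proof rests on a leave-one-out identity. Let \<open>R(p)\<close> be the number of rejections. Hypothesis
  \<open>i\<close> is rejected iff \<open>p\<^sub>i \<le> \<alpha> R(p) / K\<close>, a threshold that depends on \<open>p\<^sub>i\<close> itself. This
  dependence is only apparent: if \<open>R\<^sub>i(p)\<close> denotes the number of rejections after \<open>p\<^sub>i\<close> has been
  replaced by \<open>0\<close>, then \<open>i\<close> is rejected iff \<open>p\<^sub>i \<le> \<alpha> R\<^sub>i(p) / K\<close>, and in that case
  \<open>R(p) = R\<^sub>i(p)\<close> (lemma \<open>bh_leave_one_out\<close>). Since \<open>R\<^sub>i \<ge> 1\<close> always, the false discovery proportion
  is the sum, over the true nulls \<open>i\<close> and over \<open>r = 1, ..., K\<close>, of \<open>1 / r\<close> times the indicator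
  of the event that \<open>P\<^sub>i \<le> \<alpha> r / K\<close> and \<open>R\<^sub>i = r\<close> (lemma \<open>false_discovery_proportion_eq_sum\<close>).

  Now \<open>R\<^sub>i\<close> is a function of the p-values other than \<open>P\<^sub>i\<close>, and for a true null \<open>i\<close> these are
  jointly independent of \<open>P\<^sub>i\<close> (lemma \<open>indep_pair_remaining_coordinates\<close>). As \<open>P\<^sub>i\<close> is uniform and
  \<open>\<alpha> r / K \<le> 1\<close>, the event for \<open>(i, r)\<close> has probability \<open>\<alpha> r / K\<close> times the probability of
  \<open>R\<^sub>i = r\<close>. The factors \<open>r\<close> cancel, the probabilities of \<open>R\<^sub>i = r\<close> sum to \<open>1\<close> over \<open>r\<close>, and
  every true null contributes exactly \<open>\<alpha> / K\<close>.
\<close>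

section \<open>The Benjamini-Hochberg procedure in terms of counts\<close>

definition num_below :: "nat \<Rightarrow> (nat \<Rightarrow> real) \<Rightarrow> real \<Rightarrow> nat" where
  "num_below K p t = card {k \<in> {1..K}. p k \<le> t}"

lemma num_below_mono:
  assumes "\<And>k. k \<in> {1..K} \<Longrightarrow> q k \<le> p k" and "s \<le> t"
  shows "num_below K p s \<le> num_below K q t"
  unfolding num_below_def by (rule card_mono) (use assms in \<open>force+\<close>)

lemma num_below_le: "num_below K p t \<le> K"
proof -
  have "num_below K p t \<le> card {1..K}"
    unfolding num_below_def by (rule card_mono) auto
  then show ?thesis by simp
qed

lemma sorted_nth_le_iff_length_filter:
  fixes t :: "'b :: linorder"
  assumes "sorted xs" "j < length xs"
  shows "xs ! j \<le> t \<longleftrightarrow> j < length (filter (\<lambda>x. x \<le> t) xs)"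
  using assms
proof (induction xs arbitrary: j)
  case (Cons x xs)
  show ?case
  proof (cases "x \<le> t")
    case True
    then show ?thesis using Cons by (cases j) auto
  next
    case False
    have ge: "x \<le> y" if "y \<in> set (x # xs)" for y
      using that Cons.prems(1) by auto
    have "\<not> (x # xs) ! j \<le> t"
      using False ge[OF nth_mem[OF Cons.prems(2)]] by (meson order_trans)
    moreover have "filter (\<lambda>x. x \<le> t) (x # xs) = []"
      using False ge by (meson filter_empty_conv order_trans)
    ultimately show ?thesis by simp
  qed
qed simp

text \<open>
  This duality removes sorting from the picture: from here on, order statistics are replaced by
  the counting function of the p-values, which is monotone and visibly measurable.
\<close>

lemma order_stat_le_iff:
  assumes "1 \<le> k" "k \<le> K"
  shows "order_stat K p k \<le> t \<longleftrightarrow> k \<le> num_below K p t"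
proof -
  let ?xs = "map p [1..<Suc K]"
  have "length (filter (\<lambda>x. x \<le> t) (sort ?xs)) = length (filter (\<lambda>x. x \<le> t) ?xs)"
    by (metis mset_filter mset_sort size_mset)
  also have "\<dots> = card ({k. p k \<le> t} \<inter> set [1..<Suc K])"
    by (simp only: filter_map length_map o_def distinct_length_filter distinct_upt)
  also have "{k. p k \<le> t} \<inter> set [1..<Suc K] = {k \<in> {1..K}. p k \<le> t}"
    by auto
  finally have "length (filter (\<lambda>x. x \<le> t) (sort ?xs)) = num_below K p t"
    by (simp only: num_below_def)
  moreover have "k - 1 < length (sort ?xs)"
    using assms by simp
  ultimately show ?thesis
    using sorted_nth_le_iff_length_filter[of "sort ?xs" "k - 1" t] assms
    unfolding order_stat_def by (simp add: less_eq_Suc_le del: upt_Suc)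
qed

lemma bh_count_eq_Max_num_below:
  assumes "K \<ge> 1"
  shows "bh_count K \<alpha> p = Max {r \<in> {0..K}. r \<le> num_below K p (\<alpha> * real r / real K)}"
proof -
  have "real K * order_stat K p k / real k \<le> \<alpha> \<longleftrightarrow> k \<le> num_below K p (\<alpha> * real k / real K)"
    if "k \<in> {1..K}" for k
  proof -
    have "real K * order_stat K p k / real k \<le> \<alpha> \<longleftrightarrow> order_stat K p k \<le> \<alpha> * real k / real K"
      using that assms by (simp add: field_simps)
    then show ?thesis
      using that order_stat_le_iff by simp
  qed
  then have "insert 0 {k \<in> {1..K}. real K * order_stat K p k / real k \<le> \<alpha>}
      = {r \<in> {0..K}. r \<le> num_below K p (\<alpha> * real r / real K)}"
    by (auto simp: Suc_le_eq)
  then show ?thesis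
    by (simp only: bh_count_def)
qed

lemma bh_count_cong:
  assumes "\<And>k. k \<in> {1..K} \<Longrightarrow> p k = q k"
  shows "bh_count K \<alpha> p = bh_count K \<alpha> q"
proof -
  have "map p [1..<Suc K] = map q [1..<Suc K]"
    using assms by (intro map_cong) auto
  then show ?thesis
    by (simp only: bh_count_def order_stat_def)
qed

lemma bh_count_eqI:
  assumes "K \<ge> 1" "r \<le> K" "r \<le> num_below K p (\<alpha> * real r / real K)"
    and "\<And>s. r < s \<Longrightarrow> s \<le> K \<Longrightarrow> num_below K p (\<alpha> * real s / real K) < s"
  shows "bh_count K \<alpha> p = r"
  unfolding bh_count_eq_Max_num_below[OF assms(1)]
proof (rule Max_eqI)
  fix s assume "s \<in> {r \<in> {0..K}. r \<le> num_below K p (\<alpha> * real r / real K)}"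
  then show "s \<le> r" using assms(4)[of s] by (cases "r < s") auto
qed (use assms in auto)

lemma bh_count_self_consistent:
  assumes "K \<ge> 1"
  shows "bh_count K \<alpha> p \<le> num_below K p (\<alpha> * real (bh_count K \<alpha> p) / real K)"
proof -
  have "bh_count K \<alpha> p \<in> {r \<in> {0..K}. r \<le> num_below K p (\<alpha> * real r / real K)}"
    unfolding bh_count_eq_Max_num_below[OF assms] by (rule Max_in) force+
  then show ?thesis by simp
qed

lemma bh_count_greatest:
  assumes "K \<ge> 1" "r \<le> num_below K p (\<alpha> * real r / real K)"
  shows "r \<le> bh_count K \<alpha> p"
  unfolding bh_count_eq_Max_num_below[OF assms(1)]
  by (rule Max_ge) (use assms order_trans[OF assms(2) num_below_le] in auto)

lemma bh_count_le: "bh_count K \<alpha> p \<le> K" if "K \<ge> 1"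
  using bh_count_self_consistent[OF that] num_below_le order_trans by blast

text \<open>
  Self-consistency is an equality: if \<open>n\<close> p-values lay below the threshold belonging to a
  smaller count, then at least \<open>n\<close> would lie below the larger threshold \<open>\<alpha> n / K\<close>, so \<open>n\<close>
  itself would compete in the maximum.
\<close>

lemma num_below_bh_threshold:
  assumes "K \<ge> 1" "\<alpha> > 0"
  shows "num_below K p (\<alpha> * real (bh_count K \<alpha> p) / real K) = bh_count K \<alpha> p"
proof (rule antisym)
  let ?n = "num_below K p (\<alpha> * real (bh_count K \<alpha> p) / real K)"
  have "\<alpha> * real (bh_count K \<alpha> p) / real K \<le> \<alpha> * real ?n / real K"
    using bh_count_self_consistent[OF assms(1)] assms
    by (intro divide_right_mono mult_left_mono) auto
  then have "?n \<le> num_below K p (\<alpha> * real ?n / real K)"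
    by (intro num_below_mono) auto
  then show "?n \<le> bh_count K \<alpha> p"
    by (rule bh_count_greatest[OF assms(1)])
qed (rule bh_count_self_consistent[OF assms(1)])

text \<open>
  The definition cuts at the order statistic with index \<open>r = bh_count K \<alpha> p\<close>. This value may be
  smaller than \<open>\<alpha> r / K\<close>, but exactly \<open>r\<close> p-values lie below \<open>\<alpha> r / K\<close>, and at least \<open>r\<close> lie below
  the order statistic, so no p-value falls in between. For \<open>r = 0\<close> both sides are empty.
\<close>

lemma bh_eq_threshold:
  assumes "K \<ge> 1" "\<alpha> > 0"
  shows "bh K \<alpha> p = {k \<in> {1..K}. p k \<le> \<alpha> * real (bh_count K \<alpha> p) / real K}"
    (is "_ = ?T")
proof (cases "bh_count K \<alpha> p = 0")
  case True
  then have "card ?T = 0"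
    using num_below_bh_threshold[OF assms, of p] by (simp add: num_below_def)
  with True show ?thesis by (simp add: bh_def)
next
  case False
  let ?r = "bh_count K \<alpha> p"
  let ?B = "{k \<in> {1..K}. p k \<le> order_stat K p ?r}"
  have r: "1 \<le> ?r" "?r \<le> K" using False bh_count_le[OF assms(1)] by auto
  have "order_stat K p ?r \<le> \<alpha> * real ?r / real K"
    using order_stat_le_iff[OF r] bh_count_self_consistent[OF assms(1)] by blast
  then have "?B \<subseteq> ?T" by auto
  moreover have "card ?T \<le> card ?B"
    using order_stat_le_iff[OF r, of p "order_stat K p ?r"] num_below_bh_threshold[OF assms, of p]
    by (simp add: num_below_def)
  ultimately have "?B = ?T"
    by (intro card_seteq) auto
  with False show ?thesis by (simp add: bh_def)
qed

lemma card_bh: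
  assumes "K \<ge> 1" "\<alpha> > 0"
  shows "card (bh K \<alpha> p) = bh_count K \<alpha> p"
  using num_below_bh_threshold[OF assms, of p] bh_eq_threshold[OF assms, of p]
  by (simp add: num_below_def)

section \<open>The leave-one-out identity\<close>

text \<open>
  The zeroed p-value alone meets the first threshold \<open>\<alpha> / K\<close>. Thanks to this bound, the
  leave-one-out count can serve as the denominator of the false discovery proportion.
\<close>

lemma bh_count_zeroed_pos:
  assumes "K \<ge> 1" "\<alpha> > 0" "i \<in> {1..K}"
  shows "1 \<le> bh_count K \<alpha> (p(i := 0))"
proof (rule bh_count_greatest[OF assms(1)])
  have "card {i} \<le> num_below K (p(i := 0)) (\<alpha> * real 1 / real K)"
    unfolding num_below_def by (rule card_mono) (use assms in auto)
  then show "1 \<le> num_below K (p(i := 0)) (\<alpha> * real 1 / real K)" by simp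
qed

text \<open>
  Zeroing \<open>p i\<close> leaves the number of p-values below a threshold \<open>t \<ge> 0\<close> unchanged as
  soon as \<open>p i \<le> t\<close>. Hence if \<open>p i\<close> lies below the threshold of either of the two counts, that count is
  also a candidate in the maximum defining the other one. So each of the conditions
  \<open>p i \<le> \<alpha> R(p) / K\<close> and \<open>p i \<le> \<alpha> R\<^sub>i(p) / K\<close> implies the other, and under them the counts agree.
\<close>

lemma bh_leave_one_out:
  assumes "K \<ge> 1" "\<alpha> > 0" "i \<in> {1..K}"
  shows "i \<in> bh K \<alpha> p \<longleftrightarrow> p i \<le> \<alpha> * real (bh_count K \<alpha> (p(i := 0))) / real K"
    and "i \<in> bh K \<alpha> p \<Longrightarrow> bh_count K \<alpha> p = bh_count K \<alpha> (p(i := 0))"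
proof -
  let ?q = "p(i := 0)"
  let ?r = "bh_count K \<alpha> p" and ?s = "bh_count K \<alpha> ?q"
  let ?t = "\<lambda>r. \<alpha> * real r / real K"
  have t_mono: "?t a \<le> ?t b" if "a \<le> b" for a b
    using that assms by (intro divide_right_mono mult_left_mono) auto
  have t_nonneg: "0 \<le> ?t a" for a
    using assms by simp
  have agree: "num_below K p (?t a) = num_below K ?q (?t a)" if "p i \<le> ?t a" for a
    unfolding num_below_def using that t_nonneg[of a]
    by (intro arg_cong[where f = card]) auto
  have mem: "i \<in> bh K \<alpha> p \<longleftrightarrow> p i \<le> ?t ?r"
    using bh_eq_threshold[OF assms(1,2), of p] assms(3) by auto
  have s_le_r: "?s \<le> ?r" if "p i \<le> ?t ?s"
  proof (rule bh_count_greatest[OF assms(1)])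
    show "?s \<le> num_below K p (?t ?s)"
      unfolding agree[OF that] by (rule bh_count_self_consistent[OF assms(1)])
  qed
  have r_le_s: "?r \<le> ?s" if "p i \<le> ?t ?r"
  proof (rule bh_count_greatest[OF assms(1)])
    show "?r \<le> num_below K ?q (?t ?r)"
      unfolding agree[OF that, symmetric] by (rule bh_count_self_consistent[OF assms(1)])
  qed
  show "i \<in> bh K \<alpha> p \<longleftrightarrow> p i \<le> ?t ?s"
    unfolding mem using s_le_r r_le_s t_mono by (meson order_trans)
  show "?r = ?s" if "i \<in> bh K \<alpha> p"
    using that s_le_r r_le_s t_mono unfolding mem by (meson order_trans order_antisym)
qed

text \<open>
  Splitting over the value \<open>r\<close> of the leave-one-out count turns the random threshold for \<open>p i\<close> and
  the random denominator into constants.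
\<close>

lemma false_discovery_proportion_eq_sum:
  assumes "K \<ge> 1" "\<alpha> > 0" "N \<subseteq> {1..K}"
  shows "real (num_false_discoveries N (bh K \<alpha> p)) / real (max (num_discoveries (bh K \<alpha> p)) 1)
    = (\<Sum>i\<in>N. \<Sum>r\<in>{1..K}.
         of_bool (p i \<le> \<alpha> * real r / real K \<and> bh_count K \<alpha> (p(i := 0)) = r) / real r)"
proof -
  let ?D = "bh K \<alpha> p"
  have fin: "finite N" using assms(3) finite_subset by blast
  have "(\<Sum>r\<in>{1..K}. of_bool (p i \<le> \<alpha> * real r / real K \<and> bh_count K \<alpha> (p(i := 0)) = r) / real r)
      = of_bool (i \<in> ?D) / real (max (card ?D) 1)" if "i \<in> N" for i
  proof -
    have i: "i \<in> {1..K}" using that assms(3) by blast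
    let ?s = "bh_count K \<alpha> (p(i := 0))"
    have s: "?s \<in> {1..K}"
      using bh_count_zeroed_pos[OF assms(1,2) i] bh_count_le[OF assms(1)] by simp
    \<comment> \<open>Only the term \<open>r = ?s\<close> survives; it equals the contribution of \<open>i\<close> to the proportion.\<close>
    have "(\<Sum>r\<in>{1..K}. of_bool (p i \<le> \<alpha> * real r / real K \<and> ?s = r) / real r)
        = (\<Sum>r\<in>{1..K}. if r = ?s then of_bool (p i \<le> \<alpha> * real ?s / real K) / real ?s else 0)"
      by (intro sum.cong) auto
    also have "\<dots> = of_bool (i \<in> ?D) / real ?s"
      using s bh_leave_one_out(1)[OF assms(1,2) i, of p] by simp
    also have "\<dots> = of_bool (i \<in> ?D) / real (max (card ?D) 1)"
      using s bh_leave_one_out(2)[OF assms(1,2) i, of p] card_bh[OF assms(1,2), of p]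
      by (cases "i \<in> ?D") auto
    finally show ?thesis .
  qed
  then have "(\<Sum>i\<in>N. \<Sum>r\<in>{1..K}.
         of_bool (p i \<le> \<alpha> * real r / real K \<and> bh_count K \<alpha> (p(i := 0)) = r) / real r)
      = (\<Sum>i\<in>N. of_bool (i \<in> ?D) / real (max (card ?D) 1))"
    by (rule sum.cong[OF refl])
  also have "\<dots> = (\<Sum>i\<in>N. of_bool (i \<in> ?D)) / real (max (card ?D) 1)"
    by (rule sum_divide_distrib[symmetric])
  also have "(\<Sum>i\<in>N. of_bool (i \<in> ?D) :: real) = real (card (?D \<inter> N))"
    using fin by (simp add: of_bool_def sum.If_cases Int_commute)
  finally show ?thesis
    by (simp only: num_false_discoveries_def num_discoveries_def)
qed

text \<open>
  Stated for an arbitrary measurable vector \<open>f\<close> so that it covers both the count as a random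
  variable and the leave-one-out count as a function on the product space without coordinate \<open>i\<close>.
\<close>

lemma measurable_bh_count:
  assumes "K \<ge> 1" and [measurable]: "\<And>k. k \<in> {1..K} \<Longrightarrow> (\<lambda>\<omega>. f \<omega> k) \<in> borel_measurable M"
  shows "(\<lambda>\<omega>. bh_count K \<alpha> (f \<omega>)) \<in> measurable M (count_space UNIV)"
proof -
  have [measurable]: "(\<lambda>\<omega>. num_below K (f \<omega>) t) \<in> measurable M (count_space UNIV)" for t
  proof -
    have "num_below K (f \<omega>) t = (\<Sum>k\<in>{1..K}. if f \<omega> k \<le> t then 1 else 0)" for \<omega>
      unfolding num_below_def by (simp add: sum.If_cases Int_def)
    then show ?thesis by simp
  qed
  let ?p = "\<lambda>r \<omega>. r \<le> num_below K (f \<omega>) (\<alpha> * real r / real K)"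
  have "bh_count K \<alpha> (f \<omega>) = r \<longleftrightarrow> r \<le> K \<and> ?p r \<omega> \<and> (\<forall>s\<in>{r<..K}. \<not> ?p s \<omega>)" for r \<omega>
  proof
    assume "bh_count K \<alpha> (f \<omega>) = r"
    then show "r \<le> K \<and> ?p r \<omega> \<and> (\<forall>s\<in>{r<..K}. \<not> ?p s \<omega>)"
      using bh_count_le[OF assms(1), of \<alpha> "f \<omega>"] bh_count_self_consistent[OF assms(1), of \<alpha> "f \<omega>"]
        bh_count_greatest[OF assms(1), of _ "f \<omega>" \<alpha>] by (simp add: Ball_def) (meson not_le)
  next
    assume "r \<le> K \<and> ?p r \<omega> \<and> (\<forall>s\<in>{r<..K}. \<not> ?p s \<omega>)"
    then show "bh_count K \<alpha> (f \<omega>) = r"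
      by (intro bh_count_eqI[OF assms(1)]) (auto simp: not_le)
  qed
  then have eq: "(\<lambda>\<omega>. bh_count K \<alpha> (f \<omega>)) -` {r} \<inter> space M
      = {\<omega> \<in> space M. r \<le> K \<and> ?p r \<omega> \<and> (\<forall>s\<in>{r<..K}. \<not> ?p s \<omega>)}" for r
    by auto
  show ?thesis
    by (subst measurable_count_space_eq_countable) (auto simp: eq)
qed

section \<open>Independence of one null p-value from all the others\<close>

text \<open>
  Independence of two random variables as the product form of their joint law. The variables may
  take values in different types, unlike in \<open>indep_var\<close>: below, a number has to be independent
  of a vector, and of a pair of vectors.
\<close>

definition (in prob_space) indep_pair ::
  "'b measure \<Rightarrow> ('a \<Rightarrow> 'b) \<Rightarrow> 'c measure \<Rightarrow> ('a \<Rightarrow> 'c) \<Rightarrow> bool" where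
  "indep_pair S X T Y \<longleftrightarrow> X \<in> measurable M S \<and> Y \<in> measurable M T \<and>
     distr M S X \<Otimes>\<^sub>M distr M T Y = distr M (S \<Otimes>\<^sub>M T) (\<lambda>\<omega>. (X \<omega>, Y \<omega>))"

lemma (in prob_space) indep_pair_if_indep_var: "indep_var S X T Y \<Longrightarrow> indep_pair S X T Y"
  by (simp add: indep_pair_def indep_var_distribution_eq)

lemma (in prob_space) indep_pairD:
  assumes "indep_pair S X T Y" and A: "A \<in> sets S" and B: "B \<in> sets T"
  shows "prob {\<omega> \<in> space M. X \<omega> \<in> A \<and> Y \<omega> \<in> B}
    = prob {\<omega> \<in> space M. X \<omega> \<in> A} * prob {\<omega> \<in> space M. Y \<omega> \<in> B}"
proof -
  have rv [measurable]: "X \<in> measurable M S" "Y \<in> measurable M T"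
    using assms(1) by (auto simp: indep_pair_def)
  interpret Y: prob_space "distr M T Y" by (rule prob_space_distr) simp
  have "prob {\<omega> \<in> space M. X \<omega> \<in> A \<and> Y \<omega> \<in> B}
      = measure (distr M (S \<Otimes>\<^sub>M T) (\<lambda>\<omega>. (X \<omega>, Y \<omega>))) (A \<times> B)"
    using A B by (subst measure_distr) (auto intro!: arg_cong[where f = prob])
  also have "\<dots> = measure (distr M S X \<Otimes>\<^sub>M distr M T Y) (A \<times> B)"
    using assms(1) by (simp add: indep_pair_def)
  also have "\<dots> = measure (distr M S X) A * measure (distr M T Y) B"
    using A B by (simp add: measure_def Y.emeasure_pair_measure_Times enn2real_mult)
  also have "measure (distr M S X) A = prob {\<omega> \<in> space M. X \<omega> \<in> A}"
    using A by (subst measure_distr) (auto intro!: arg_cong[where f = prob])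
  also have "measure (distr M T Y) B = prob {\<omega> \<in> space M. Y \<omega> \<in> B}"
    using B by (subst measure_distr) (auto intro!: arg_cong[where f = prob])
  finally show ?thesis .
qed

lemma (in prob_space) indep_pair_compose:
  assumes XY: "indep_pair S X T Y"
    and f [measurable]: "f \<in> measurable S S'" and g [measurable]: "g \<in> measurable T T'"
  shows "indep_pair S' (\<lambda>\<omega>. f (X \<omega>)) T' (\<lambda>\<omega>. g (Y \<omega>))"
proof -
  have rv [measurable]: "X \<in> measurable M S" "Y \<in> measurable M T"
    using XY by (auto simp: indep_pair_def)
  let ?X = "distr M S X" and ?Y = "distr M T Y"
  interpret Y: prob_space ?Y by (rule prob_space_distr) simp
  interpret gY: prob_space "distr ?Y T' g" by (rule Y.prob_space_distr) simp
  have "distr M S' (\<lambda>\<omega>. f (X \<omega>)) \<Otimes>\<^sub>M distr M T' (\<lambda>\<omega>. g (Y \<omega>)) = distr ?X S' f \<Otimes>\<^sub>M distr ?Y T' g"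
    by (simp add: distr_distr comp_def)
  also have "\<dots> = distr (?X \<Otimes>\<^sub>M ?Y) (S' \<Otimes>\<^sub>M T') (\<lambda>(x, y). (f x, g y))"
    by (rule pair_measure_distr) (simp_all add: gY.sigma_finite_measure_axioms)
  also have "?X \<Otimes>\<^sub>M ?Y = distr M (S \<Otimes>\<^sub>M T) (\<lambda>\<omega>. (X \<omega>, Y \<omega>))"
    using XY by (simp add: indep_pair_def)
  also have "distr \<dots> (S' \<Otimes>\<^sub>M T') (\<lambda>(x, y). (f x, g y))
      = distr M (S' \<Otimes>\<^sub>M T') (\<lambda>\<omega>. (f (X \<omega>), g (Y \<omega>)))"
    by (subst distr_distr) (simp_all add: comp_def)
  finally show ?thesis by (simp add: indep_pair_def)
qed

text \<open>
  Rebracketing, by Fubini on rectangles: for fixed \<open>z\<close>, the slice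
  of \<open>{(x, y, z). x \<in> A \<and> (y, z) \<in> B}\<close> is the rectangle of \<open>A\<close> and the slice of \<open>B\<close> at \<open>z\<close>, so its
  measure under the law of \<open>(X, Y)\<close> has the constant factor \<open>P(X \<in> A)\<close>. Integrating the other
  factor over \<open>z\<close> gives \<open>P((Y, Z) \<in> B)\<close>.
\<close>

lemma (in prob_space) indep_pair_assoc:
  assumes XY: "indep_pair S X T Y"
    and XYZ: "indep_pair (S \<Otimes>\<^sub>M T) (\<lambda>\<omega>. (X \<omega>, Y \<omega>)) U Z"
  shows "indep_pair S X (T \<Otimes>\<^sub>M U) (\<lambda>\<omega>. (Y \<omega>, Z \<omega>))"
proof -
  have rv[measurable]: "X \<in> measurable M S" "Y \<in> measurable M T" "Z \<in> measurable M U"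
    using XY XYZ by (auto simp: indep_pair_def)
  have YZ: "indep_pair T Y U Z"
    using indep_pair_compose[OF XYZ, of snd T "\<lambda>z. z" U] by simp
  let ?X = "distr M S X" and ?Y = "distr M T Y" and ?Z = "distr M U Z"
  interpret X: prob_space ?X by (rule prob_space_distr) simp
  interpret Y: prob_space ?Y by (rule prob_space_distr) simp
  interpret Z: prob_space ?Z by (rule prob_space_distr) simp
  interpret XY: pair_prob_space ?X ?Y ..
  interpret YZ: pair_prob_space ?Y ?Z ..
  interpret XYZ: pair_prob_space "?X \<Otimes>\<^sub>M ?Y" ?Z ..
  have dYZ: "distr M (T \<Otimes>\<^sub>M U) (\<lambda>\<omega>. (Y \<omega>, Z \<omega>)) = ?Y \<Otimes>\<^sub>M ?Z"
    using YZ by (simp add: indep_pair_def)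
  have dXYZ: "distr M ((S \<Otimes>\<^sub>M T) \<Otimes>\<^sub>M U) (\<lambda>\<omega>. ((X \<omega>, Y \<omega>), Z \<omega>)) = (?X \<Otimes>\<^sub>M ?Y) \<Otimes>\<^sub>M ?Z"
    using XYZ XY by (simp add: indep_pair_def)
  have "?X \<Otimes>\<^sub>M (?Y \<Otimes>\<^sub>M ?Z) = distr M (S \<Otimes>\<^sub>M (T \<Otimes>\<^sub>M U)) (\<lambda>\<omega>. (X \<omega>, Y \<omega>, Z \<omega>))"
  proof (rule pair_measure_eqI)
    show "sigma_finite_measure ?X" "sigma_finite_measure (?Y \<Otimes>\<^sub>M ?Z)"
      by unfold_locales
    show "sets (?X \<Otimes>\<^sub>M (?Y \<Otimes>\<^sub>M ?Z)) = sets (distr M (S \<Otimes>\<^sub>M (T \<Otimes>\<^sub>M U)) (\<lambda>\<omega>. (X \<omega>, Y \<omega>, Z \<omega>)))"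
      by (simp cong: sets_pair_measure_cong)
  next
    fix A B assume A: "A \<in> sets ?X" and B: "B \<in> sets (?Y \<Otimes>\<^sub>M ?Z)"
    have A' [measurable]: "A \<in> sets S" using A by simp
    have B' [measurable]: "B \<in> sets (T \<Otimes>\<^sub>M U)"
      using B by (simp cong: sets_pair_measure_cong)
    let ?C = "{w \<in> space ((S \<Otimes>\<^sub>M T) \<Otimes>\<^sub>M U). fst (fst w) \<in> A \<and> (snd (fst w), snd w) \<in> B}"
    have C [measurable]: "?C \<in> sets ((S \<Otimes>\<^sub>M T) \<Otimes>\<^sub>M U)" by measurable
    then have C': "?C \<in> sets ((?X \<Otimes>\<^sub>M ?Y) \<Otimes>\<^sub>M ?Z)"
      by (simp cong: sets_pair_measure_cong)
    have slice: "(\<lambda>w. (w, z)) -` ?C = A \<times> (\<lambda>y. (y, z)) -` B" if "z \<in> space U" for z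
      using that sets.sets_into_space[OF A'] sets.sets_into_space[OF B']
      by (auto simp: space_pair_measure)
    have "emeasure (distr M (S \<Otimes>\<^sub>M (T \<Otimes>\<^sub>M U)) (\<lambda>\<omega>. (X \<omega>, Y \<omega>, Z \<omega>))) (A \<times> B)
        = emeasure M ((\<lambda>\<omega>. (X \<omega>, Y \<omega>, Z \<omega>)) -` (A \<times> B) \<inter> space M)"
      by (rule emeasure_distr) auto
    also have "(\<lambda>\<omega>. (X \<omega>, Y \<omega>, Z \<omega>)) -` (A \<times> B) \<inter> space M
        = (\<lambda>\<omega>. ((X \<omega>, Y \<omega>), Z \<omega>)) -` ?C \<inter> space M"
      using rv[THEN measurable_space] by (auto simp: space_pair_measure)
    also have "emeasure M \<dots> = emeasure ((?X \<Otimes>\<^sub>M ?Y) \<Otimes>\<^sub>M ?Z) ?C"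
      unfolding dXYZ[symmetric] by (rule emeasure_distr[symmetric]) auto
    also have "\<dots> = (\<integral>\<^sup>+z. emeasure (?X \<Otimes>\<^sub>M ?Y) ((\<lambda>w. (w, z)) -` ?C) \<partial>?Z)"
      by (rule XYZ.emeasure_pair_measure_alt2[OF C'])
    also have "\<dots> = (\<integral>\<^sup>+z. emeasure ?X A * emeasure ?Y ((\<lambda>y. (y, z)) -` B) \<partial>?Z)"
    proof (rule nn_integral_cong)
      fix z assume "z \<in> space ?Z"
      then show "emeasure (?X \<Otimes>\<^sub>M ?Y) ((\<lambda>w. (w, z)) -` ?C)
          = emeasure ?X A * emeasure ?Y ((\<lambda>y. (y, z)) -` B)"
        using slice[of z] sets_Pair2[OF B, of z] A
        by (simp add: Y.emeasure_pair_measure_Times)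
    qed
    also have "\<dots> = emeasure ?X A * (\<integral>\<^sup>+z. emeasure ?Y ((\<lambda>y. (y, z)) -` B) \<partial>?Z)"
      by (rule nn_integral_cmult) (rule YZ.measurable_emeasure_Pair2[OF B])
    also have "\<dots> = emeasure ?X A * emeasure (?Y \<Otimes>\<^sub>M ?Z) B"
      by (simp add: YZ.emeasure_pair_measure_alt2[OF B])
    finally show "emeasure ?X A * emeasure (?Y \<Otimes>\<^sub>M ?Z) B
        = emeasure (distr M (S \<Otimes>\<^sub>M (T \<Otimes>\<^sub>M U)) (\<lambda>\<omega>. (X \<omega>, Y \<omega>, Z \<omega>))) (A \<times> B)" ..
  qed
  then show ?thesis
    by (simp add: indep_pair_def dYZ)
qed

text \<open>
  \<open>P i\<close> is independent of the other coordinates in \<open>N\<close>, and together they are independent of the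
  coordinates outside \<open>N\<close>. Rebracketing makes \<open>P i\<close> independent of the pair of these two blocks,
  which \<open>merge\<close> glues to the vector of all coordinates other than \<open>i\<close>.
\<close>

lemma (in prob_space) indep_pair_remaining_coordinates:
  fixes P :: "'i \<Rightarrow> 'a \<Rightarrow> 'b :: topological_space"
  assumes N: "N \<subseteq> I" "i \<in> N"
    and indep: "indep_vars (\<lambda>_. borel) P N"
    and blocks: "indep_var (Pi\<^sub>M N (\<lambda>_. borel)) (\<lambda>\<omega>. \<lambda>k\<in>N. P k \<omega>)
                   (Pi\<^sub>M (I - N) (\<lambda>_. borel)) (\<lambda>\<omega>. \<lambda>k\<in>I - N. P k \<omega>)"
  shows "indep_pair borel (P i) (Pi\<^sub>M (I - {i}) (\<lambda>_. borel)) (\<lambda>\<omega>. \<lambda>k\<in>I - {i}. P k \<omega>)"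
proof -
  let ?B = "\<lambda>J. Pi\<^sub>M J (\<lambda>_. borel :: 'b measure)"
  let ?R = "\<lambda>J \<omega>. \<lambda>k\<in>J. P k \<omega>"
  have 1: "indep_pair borel (P i) (?B (N - {i})) (?R (N - {i}))"
  proof -
    have "indep_var (?B {i}) (?R {i}) (?B (N - {i})) (?R (N - {i}))"
      by (rule indep_var_restrict[OF indep]) (use N in auto)
    from indep_pair_compose[OF indep_pair_if_indep_var[OF this] measurable_component_singleton measurable_ident]
    have "indep_pair borel (\<lambda>\<omega>. ?R {i} \<omega> i) (?B (N - {i})) (\<lambda>\<omega>. id (?R (N - {i}) \<omega>))"
      by blast
    moreover have "(\<lambda>\<omega>. ?R {i} \<omega> i) = P i"
      by (simp add: fun_eq_iff)
    ultimately show ?thesis by (simp only: id_apply)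
  qed
  have 2: "indep_pair (borel \<Otimes>\<^sub>M ?B (N - {i})) (\<lambda>\<omega>. (P i \<omega>, ?R (N - {i}) \<omega>))
      (?B (I - N)) (?R (I - N))"
  proof -
    have "(\<lambda>x. (x i, restrict x (N - {i}))) \<in> measurable (?B N) (borel \<Otimes>\<^sub>M ?B (N - {i}))"
      using N by (intro measurable_Pair measurable_component_singleton measurable_restrict_subset) auto
    from indep_pair_compose[OF indep_pair_if_indep_var[OF blocks] this measurable_ident]
    have "indep_pair (borel \<Otimes>\<^sub>M ?B (N - {i})) (\<lambda>\<omega>. (?R N \<omega> i, restrict (?R N \<omega>) (N - {i})))
        (?B (I - N)) (?R (I - N))"
      by (simp only: id_apply)
    moreover have "(\<lambda>\<omega>. (?R N \<omega> i, restrict (?R N \<omega>) (N - {i}))) = (\<lambda>\<omega>. (P i \<omega>, ?R (N - {i}) \<omega>))"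
      using N by (auto simp: fun_eq_iff restrict_def)
    ultimately show ?thesis by (simp only:)
  qed
  have "(N - {i}) \<union> (I - N) = I - {i}"
    using N by auto
  then have 3: "merge (N - {i}) (I - N) \<in> measurable (?B (N - {i}) \<Otimes>\<^sub>M ?B (I - N)) (?B (I - {i}))"
    using measurable_merge[of "N - {i}" "I - N" "\<lambda>_. borel :: 'b measure"] by (simp only:)
  have "indep_pair borel (P i) (?B (I - {i}))
      (\<lambda>\<omega>. merge (N - {i}) (I - N) (?R (N - {i}) \<omega>, ?R (I - N) \<omega>))"
    using indep_pair_compose[OF indep_pair_assoc[OF 1 2] measurable_ident 3] by (simp only: id_apply)
  moreover have "(\<lambda>\<omega>. merge (N - {i}) (I - N) (?R (N - {i}) \<omega>, ?R (I - N) \<omega>)) = ?R (I - {i})"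
    using N by (auto simp: fun_eq_iff merge_def restrict_def)
  ultimately show ?thesis by (simp only:)
qed

section \<open>The false discovery rate\<close>

lemma (in prob_space) prob_uniform_le:
  assumes [measurable]: "X \<in> borel_measurable M"
    and "distr M borel X = uniform_measure lborel {0..1 :: real}" and "0 \<le> c" "c \<le> 1"
  shows "prob {\<omega> \<in> space M. X \<omega> \<le> c} = c"
proof -
  have "prob {\<omega> \<in> space M. X \<omega> \<le> c} = measure (distr M borel X) {..c}"
    by (subst measure_distr) (auto intro!: arg_cong[where f = prob])
  also have "\<dots> = measure lborel ({0..1} \<inter> {..c})"
    unfolding assms(2) by (subst measure_uniform_measure) auto
  also have "{0..1} \<inter> {..c} = {0..c}"
    using assms by auto
  finally show ?thesis using assms by simp
qed

theorem theorem1: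
  fixes M :: "'a measure"
    and P :: "nat \<Rightarrow> 'a \<Rightarrow> real"
    and K :: nat
    and N :: "nat set"
    and \<alpha> :: real
  assumes "prob_space M"
    and "K \<ge> 1"
    and "N \<subseteq> {1..K}"
    and "\<And>k. k \<in> {1..K} \<Longrightarrow> P k \<in> borel_measurable M"
    and "\<And>k \<omega>. k \<in> {1..K} \<Longrightarrow> \<omega> \<in> space M \<Longrightarrow> 0 \<le> P k \<omega>"
    and "\<And>k. k \<in> N \<Longrightarrow> distr M borel (P k) = uniform_measure lborel {0..1}"
    and "prob_space.indep_vars M (\<lambda>_. borel) P N"
    and "prob_space.indep_var M
           (Pi\<^sub>M N (\<lambda>_. borel)) (\<lambda>\<omega>. \<lambda>k\<in>N. P k \<omega>)
           (Pi\<^sub>M ({1..K} - N) (\<lambda>_. borel)) (\<lambda>\<omega>. \<lambda>k\<in>{1..K} - N. P k \<omega>)"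
    and "0 < \<alpha>" and "\<alpha> < 1"
  shows "fdr M N (bh K \<alpha>) P = \<alpha> * real (card N) / real K"
proof -
  interpret prob_space M by fact
  note K = \<open>K \<ge> 1\<close> and \<alpha> = \<open>0 < \<alpha>\<close> and N = \<open>N \<subseteq> {1..K}\<close>
  let ?R = "\<lambda>i \<omega>. bh_count K \<alpha> ((\<lambda>k. P k \<omega>)(i := 0))"
  let ?E = "\<lambda>i r. {\<omega> \<in> space M. P i \<omega> \<le> \<alpha> * real r / real K \<and> ?R i \<omega> = r}"
  have P [measurable]: "P k \<in> borel_measurable M" if "k \<in> {1..K}" for k
    using that assms(4) by blast
  have R [measurable]: "?R i \<in> measurable M (count_space UNIV)" for i
    by (rule measurable_bh_count[OF K]) (auto simp: fun_upd_def intro: P)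
  have E [measurable]: "?E i r \<in> sets M" if "i \<in> N" for i r
  proof -
    have [measurable]: "P i \<in> borel_measurable M" using that N P by blast
    show ?thesis by measurable
  qed
  have prob_E: "prob (?E i r) = \<alpha> * real r / real K * prob {\<omega> \<in> space M. ?R i \<omega> = r}"
    if i: "i \<in> N" and r: "r \<in> {1..K}" for i r
  proof -
    let ?c = "\<alpha> * real r / real K"
    have iK: "i \<in> {1..K}" using i N by blast
    have c: "0 \<le> ?c" "?c \<le> 1"
    proof -
      have "\<alpha> * real r \<le> 1 * real K"
        using r \<alpha> \<open>\<alpha> < 1\<close> by (intro mult_mono) auto
      then show "?c \<le> 1" using K by simp
    qed (use \<alpha> in simp)
    \<comment> \<open>The leave-one-out count ignores coordinate \<open>i\<close>, so it factors through the other coordinates.\<close>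
    define g where "g x = bh_count K \<alpha> (x(i := 0))" for x :: "nat \<Rightarrow> real"
    have g: "g \<in> measurable (Pi\<^sub>M ({1..K} - {i}) (\<lambda>_. borel)) (count_space UNIV)"
      unfolding g_def
    proof (rule measurable_bh_count[OF K])
      fix k assume "k \<in> {1..K}"
      then show "(\<lambda>x. (x(i := 0)) k) \<in> borel_measurable (Pi\<^sub>M ({1..K} - {i}) (\<lambda>_. borel))"
        by (cases "k = i") (auto intro!: measurable_component_singleton)
    qed
    have "indep_pair borel (P i) (count_space UNIV) (\<lambda>\<omega>. g (\<lambda>k\<in>{1..K} - {i}. P k \<omega>))"
      by (rule indep_pair_compose[OF indep_pair_remaining_coordinates[OF N i assms(7,8)] _ g,
            of "\<lambda>x. x" borel]) simp
    moreover have "(\<lambda>\<omega>. g (\<lambda>k\<in>{1..K} - {i}. P k \<omega>)) = ?R i"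
      unfolding g_def by (intro ext bh_count_cong) auto
    ultimately have ind: "indep_pair borel (P i) (count_space UNIV) (?R i)" by (simp only:)
    have "prob (?E i r) = prob {\<omega> \<in> space M. P i \<omega> \<le> ?c} * prob {\<omega> \<in> space M. ?R i \<omega> = r}"
      using indep_pairD[OF ind, of "{..?c}" "{r}"] by simp
    also have "prob {\<omega> \<in> space M. P i \<omega> \<le> ?c} = ?c"
      by (rule prob_uniform_le[OF P[OF iK] assms(6)[OF i] c])
    finally show ?thesis .
  qed
  have total: "(\<Sum>r\<in>{1..K}. prob {\<omega> \<in> space M. ?R i \<omega> = r}) = 1" if i: "i \<in> N" for i
  proof -
    have "(\<Sum>r\<in>{1..K}. prob {\<omega> \<in> space M. ?R i \<omega> = r})
        = prob (\<Union>r\<in>{1..K}. {\<omega> \<in> space M. ?R i \<omega> = r})"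
      by (rule finite_measure_finite_Union[symmetric]) (auto simp: disjoint_family_on_def)
    also have "(\<Union>r\<in>{1..K}. {\<omega> \<in> space M. ?R i \<omega> = r}) = space M"
      using bh_count_zeroed_pos[OF K \<alpha>, of i] bh_count_le[OF K] i N by (auto simp del: fun_upd_apply)
    finally show ?thesis by (simp only: prob_space)
  qed
  have int: "integrable M (\<lambda>\<omega>. indicator (?E i r) \<omega> / real r)" if "i \<in> N" for i r
    using E[OF that] by (intro integrable_divide integrable_real_indicator)
      (simp_all add: less_top[symmetric])
  have "fdr M N (bh K \<alpha>) P
      = expectation (\<lambda>\<omega>. \<Sum>i\<in>N. \<Sum>r\<in>{1..K}. indicator (?E i r) \<omega> / real r)"
    unfolding fdr_def false_discovery_proportion_eq_sum[OF K \<alpha> N]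
    by (intro Bochner_Integration.integral_cong refl sum.cong) (auto simp: indicator_def)
  also have "\<dots> = (\<Sum>i\<in>N. expectation (\<lambda>\<omega>. \<Sum>r\<in>{1..K}. indicator (?E i r) \<omega> / real r))"
    by (rule Bochner_Integration.integral_sum) (rule Bochner_Integration.integrable_sum[OF int])
  also have "\<dots> = (\<Sum>i\<in>N. \<Sum>r\<in>{1..K}. expectation (\<lambda>\<omega>. indicator (?E i r) \<omega> / real r))"
    by (rule sum.cong[OF refl], rule Bochner_Integration.integral_sum) (rule int)
  also have "\<dots> = (\<Sum>i\<in>N. \<Sum>r\<in>{1..K}. prob (?E i r) / real r)"
    by (intro sum.cong refl) (simp add: Int_absorb2)
  \<comment> \<open>The weight \<open>1 / r\<close> cancels the factor \<open>r\<close> in the probability \<open>\<alpha> r / K\<close>.\<close>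
  also have "\<dots> = (\<Sum>i\<in>N. \<Sum>r\<in>{1..K}. \<alpha> / real K * prob {\<omega> \<in> space M. ?R i \<omega> = r})"
    by (intro sum.cong refl) (simp only: prob_E, simp)
  also have "\<dots> = (\<Sum>i\<in>N. \<alpha> / real K)"
    by (intro sum.cong refl) (simp only: sum_distrib_left[symmetric] total mult_1_right)
  also have "\<dots> = \<alpha> * real (card N) / real K"
    by simp
  finally show ?thesis .
qed

end
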